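(* Let $\mathbb{K}$ be an algebraically closed field of characteristic different from $2$. Every $2$-dimensional noncommutative $G_2$-associative $\mathbb{K}$-algebra is isomorphic to an algebra with basis $\{e_1,e_2\}$ and one of the following multiplications: (1) $e_1e_1=0$, $e_1e_2=0$, $e_2e_1=-2e_1$, $e_2e_2=-2e_2$; or $e_1e_1=0$, $e_1e_2=2e_1$, $e_2e_1=0$, $e_2e_2=2e_2$ (these are the associative ones); (2) $e_1e_1=e_2$, $e_1e_2=0$, $e_2e_1=-2e_1$, $e_2e_2=-4e_2$; (3) $e_1e_1=0$, $e_1e_2=0$, $e_2e_1=-2e_1$, $e_2e_2=\beta_4e_2$, with $\beta_4\in\mathbb{K}$; (4) $e_1e_1=0$, $e_1e_2=(\alpha_2+1)e_1$, $e_2e_1=(\alpha_2-1)e_1$, $e_2e_2=(\alpha_2+1)e_2$, with $\alpha_2\in\mathbb{K}$; (5) $e_1e_1=0$, $e_1e_2=2e_1$, $e_2e_1=0$, $e_2e_2=e_1+2e_2$; (6) $e_1e_1=0$, $e_1e_2=0$, $e_2e_1=-2e_1$, $e_2e_2=e_1-2e_2$.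
   Context: A $\mathbb{K}$-algebra is a $\mathbb{K}$-vector space $V$ with an arbitrary bilinear multiplication $\mu:V\times V\to V$; $e_ie_j$ denotes $\mu(e_i,e_j)$. Its associator is $A_\mu(x,y,z)=\mu(\mu(x,y),z)-\mu(x,\mu(y,z))$. For a subgroup $G$ of the symmetric group $\Sigma_3$, the algebra is $G$-associative if $\sum_{\sigma\in G}\varepsilon(\sigma)A_\mu(x_{\sigma(1)},x_{\sigma(2)},x_{\sigma(3)})=0$ for all $x_1,x_2,x_3\in V$, where $\varepsilon(\sigma)$ is the sign of $\sigma$. Here $G_2=\{\mathrm{Id},\tau_{12}\}$, with $\tau_{12}$ the transposition of $1$ and $2$, so $G_2$-associativity means $A_\mu(x,y,z)=A_\mu(y,x,z)$ for all $x,y,z\in V$. *)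

theory Defs
  imports
    "HOL-Computational_Algebra.Polynomial"
    "HOL-Analysis.Product_Vector"
    "HOL-Algebra.Sym_Groups"
begin

definition K_algebra :: "('k::field \<Rightarrow> 'v::ab_group_add \<Rightarrow> 'v) \<Rightarrow> ('v \<Rightarrow> 'v \<Rightarrow> 'v) \<Rightarrow> bool" where
  "K_algebra smul \<mu> \<longleftrightarrow> vector_space smul \<and>
     (\<forall>x. Vector_Spaces.linear smul smul (\<lambda>y. \<mu> x y)) \<and>
     (\<forall>y. Vector_Spaces.linear smul smul (\<lambda>x. \<mu> x y))"

definition noncommutative :: "('v \<Rightarrow> 'v \<Rightarrow> 'v) \<Rightarrow> bool" where
  "noncommutative \<mu> \<longleftrightarrow> (\<exists>x y. \<mu> x y \<noteq> \<mu> y x)"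

definition associator :: "('v::ab_group_add \<Rightarrow> 'v \<Rightarrow> 'v) \<Rightarrow> 'v \<Rightarrow> 'v \<Rightarrow> 'v \<Rightarrow> 'v" where
  "associator \<mu> x y z = \<mu> (\<mu> x y) z - \<mu> x (\<mu> y z)"

definition associative :: "('v::ab_group_add \<Rightarrow> 'v \<Rightarrow> 'v) \<Rightarrow> bool" where
  "associative \<mu> \<longleftrightarrow> (\<forall>x y z. associator \<mu> x y z = 0)"

(* Intended for subgroups G of sym_group 3.  A triple of vectors is a family x of which
   only the values at 1, 2, 3 matter, since G permutes {1..3}. *)
definition G_associative ::
    "('k::field \<Rightarrow> 'v::ab_group_add \<Rightarrow> 'v) \<Rightarrow> (nat \<Rightarrow> nat) set \<Rightarrow> ('v \<Rightarrow> 'v \<Rightarrow> 'v) \<Rightarrow> bool" where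
  "G_associative smul G \<mu> \<longleftrightarrow> (\<forall>x :: nat \<Rightarrow> 'v.
     (\<Sum>\<sigma>\<in>G. smul (of_int (sign \<sigma>)) (associator \<mu> (x (\<sigma> 1)) (x (\<sigma> 2)) (x (\<sigma> 3)))) = 0)"

definition G2 :: "(nat \<Rightarrow> nat) set" where
  "G2 = {id, transpose 1 2}"

definition algebra_isomorphic ::
    "('k::field \<Rightarrow> 'v::ab_group_add \<Rightarrow> 'v) \<Rightarrow> ('v \<Rightarrow> 'v \<Rightarrow> 'v) \<Rightarrow>
     ('k \<Rightarrow> 'w::ab_group_add \<Rightarrow> 'w) \<Rightarrow> ('w \<Rightarrow> 'w \<Rightarrow> 'w) \<Rightarrow> bool" where
  "algebra_isomorphic smul \<mu> smul' \<mu>' \<longleftrightarrow>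
     (\<exists>f. Vector_Spaces.linear smul smul' f \<and> bij f \<and> (\<forall>x y. f (\<mu> x y) = \<mu>' (f x) (f y)))"

abbreviation pair_scale :: "'k::field \<Rightarrow> 'k \<times> 'k \<Rightarrow> 'k \<times> 'k" where
  "pair_scale \<equiv> module_prod.scale (*) (*)"

(* The pair (a, b) stands for a e1 + b e2, so e1 = (1, 0) and e2 = (0, 1).  The arguments
   of table_mult are the products e1 e1, e1 e2, e2 e1, e2 e2, in this order. *)
definition table_mult ::
    "'k::field \<times> 'k \<Rightarrow> 'k \<times> 'k \<Rightarrow> 'k \<times> 'k \<Rightarrow> 'k \<times> 'k \<Rightarrow> 'k \<times> 'k \<Rightarrow> 'k \<times> 'k \<Rightarrow> 'k \<times> 'k" where
  "table_mult e11 e12 e21 e22 u v =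
     pair_scale (fst u * fst v) e11 + pair_scale (fst u * snd v) e12 +
     pair_scale (snd u * fst v) e21 + pair_scale (snd u * snd v) e22"

definition isomorphic_to_table ::
    "('k::field \<Rightarrow> 'v::ab_group_add \<Rightarrow> 'v) \<Rightarrow> ('v \<Rightarrow> 'v \<Rightarrow> 'v) \<Rightarrow>
     'k \<times> 'k \<Rightarrow> 'k \<times> 'k \<Rightarrow> 'k \<times> 'k \<Rightarrow> 'k \<times> 'k \<Rightarrow> bool" where
  "isomorphic_to_table smul \<mu> e11 e12 e21 e22 \<longleftrightarrow>
     algebra_isomorphic smul \<mu> pair_scale (table_mult e11 e12 e21 e22)"

lemma pair_scale_simp [simp]: "pair_scale c (a, b) = (c * a, c * b)" for c :: "'k::field"
proof -
  interpret module_prod "(*) :: 'k \<Rightarrow> 'k \<Rightarrow> 'k" "(*) :: 'k \<Rightarrow> 'k \<Rightarrow> 'k"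
    by unfold_locales (simp_all add: algebra_simps)
  show ?thesis by (rule scale_prod)
qed

lemma pair_scale_fst: "fst (pair_scale c v) = c * fst v"
  by (cases v) simp

lemma pair_scale_snd: "snd (pair_scale c v) = c * snd v"
  by (cases v) simp

lemma table_mult_basis [simp]:
  "table_mult e11 e12 e21 e22 (1, 0) (1, 0) = e11"
  "table_mult e11 e12 e21 e22 (1, 0) (0, 1) = e12"
  "table_mult e11 e12 e21 e22 (0, 1) (1, 0) = e21"
  "table_mult e11 e12 e21 e22 (0, 1) (0, 1) = e22"
  by (cases e11, cases e12, cases e21, cases e22, simp add: table_mult_def)+

lemma vector_space_pair_scale: "vector_space (pair_scale :: 'k::field \<Rightarrow> _)"
  by unfold_locales (auto simp: algebra_simps)

lemma K_algebra_table_mult: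
  fixes e11 e12 e21 e22 :: "'k::field \<times> 'k"
  shows "K_algebra pair_scale (table_mult e11 e12 e21 e22)"
proof -
  interpret vector_space "pair_scale :: 'k \<Rightarrow> _"
    by (rule vector_space_pair_scale)
  have m: "module (pair_scale :: 'k \<Rightarrow> _)"
    by (rule module_axioms)
  have "Vector_Spaces.linear pair_scale pair_scale (\<lambda>y. table_mult e11 e12 e21 e22 x y)" for x
    unfolding linear_iff_module_hom module_hom_iff
    by (simp add: m table_mult_def scale_right_distrib scale_left_distrib distrib_left
        pair_scale_fst pair_scale_snd mult_ac add_ac)
  moreover have "Vector_Spaces.linear pair_scale pair_scale (\<lambda>x. table_mult e11 e12 e21 e22 x y)" for y
    unfolding linear_iff_module_hom module_hom_iff
    by (simp add: m table_mult_def scale_right_distrib scale_left_distrib distrib_left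
        pair_scale_fst pair_scale_snd mult_ac add_ac)
  ultimately show ?thesis
    by (simp add: K_algebra_def vector_space_pair_scale)
qed

lemma subgroup_G2: "subgroup G2 (sym_group 3)"
proof -
  have tr: "transpose 1 2 permutes {1..3::nat}"
    by (rule permutes_swap_id) auto
  have sub: "G2 \<subseteq> carrier (sym_group 3)"
    using tr permutes_id by (auto simp: G2_def sym_group_carrier)
  show ?thesis
  proof (rule group.subgroupI[OF sym_group_is_group sub])
    show "inv\<^bsub>sym_group 3\<^esub> p \<in> G2" if "p \<in> G2" for p
      using that tr permutes_id[of "{1..3::nat}"]
      by (auto simp: G2_def sym_group_carrier)
  qed (auto simp: G2_def sym_group_mult)
qed

lemma G2_associative_iff:
  assumes "K_algebra smul \<mu>"
  shows "G_associative smul G2 \<mu> \<longleftrightarrow> (\<forall>x y z. associator \<mu> x y z = associator \<mu> y x z)"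
proof -
  interpret vector_space smul using assms by (simp add: K_algebra_def)
  have ne: "id \<noteq> transpose 1 (2::nat)"
    by (auto simp: fun_eq_iff transpose_def)
  have eq: "(\<Sum>\<sigma>\<in>G2. smul (of_int (sign \<sigma>)) (associator \<mu> (x (\<sigma> 1)) (x (\<sigma> 2)) (x (\<sigma> 3))))
      = associator \<mu> (x 1) (x 2) (x 3) - associator \<mu> (x 2) (x 1) (x 3)" for x :: "nat \<Rightarrow> 'b"
    using ne by (simp add: G2_def sign_swap_id)
  show ?thesis
  proof
    assume *: "G_associative smul G2 \<mu>"
    show "\<forall>x y z. associator \<mu> x y z = associator \<mu> y x z"
    proof (intro allI)
      fix x y z
      show "associator \<mu> x y z = associator \<mu> y x z"
        using *[unfolded G_associative_def eq, rule_format,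
            of "\<lambda>i. if i = 1 then x else if i = 2 then y else z"] by simp
    qed
  qed (unfold G_associative_def eq, simp)
qed

end

theory Submission
  imports Defs
begin

text \<open>The commutator of a two-dimensional algebra is an alternating bilinear map on a plane, so its
  image is at most a line, and if it is nonzero there is a basis with \<open>e\<^sub>1 e\<^sub>2 - e\<^sub>2 e\<^sub>1 = 2 e\<^sub>1\<close>.
  Then \<open>G\<^sub>2\<close>-associativity says \<open>2 L\<^sub>1 = L\<^sub>1 L\<^sub>2 - L\<^sub>2 L\<^sub>1\<close> for the left multiplications \<open>L\<^sub>i\<close> by \<open>e\<^sub>i\<close>,
  which in characteristic different from 2 forces \<open>L\<^sub>1\<close> to be nilpotent. The normal forms are
  obtained by distinguishing whether \<open>e\<^sub>1 e\<^sub>1\<close> vanishes and then whether \<open>e\<^sub>1 e\<^sub>2\<close> vanishes, using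
  the remaining freedom \<open>e\<^sub>1 \<mapsto> s e\<^sub>1\<close>, \<open>e\<^sub>2 \<mapsto> e\<^sub>2 + t e\<^sub>1\<close>.\<close>

section \<open>Invariance of associativity, and invertibility of 2\<close>

lemma associative_iff: "associative \<mu> \<longleftrightarrow> (\<forall>x y z. \<mu> (\<mu> x y) z = \<mu> x (\<mu> y z))"
  by (simp add: associative_def associator_def)

text \<open>Lets the associativity of an abstract algebra be tested on its multiplication
  table.\<close>

lemma algebra_isomorphic_associative:
  assumes "algebra_isomorphic smul \<mu> smul' \<mu>'"
  shows "associative \<mu> \<longleftrightarrow> associative \<mu>'"
proof -
  obtain f where f: "bij f" "\<And>x y. f (\<mu> x y) = \<mu>' (f x) (f y)"
    using assms by (auto simp: algebra_isomorphic_def)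
  have "associative \<mu> \<longleftrightarrow> (\<forall>x y z. f (\<mu> (\<mu> x y) z) = f (\<mu> x (\<mu> y z)))"
    using bij_is_inj[OF f(1)] by (simp add: associative_iff inj_eq)
  also have "\<dots> \<longleftrightarrow> (\<forall>x y z. \<mu>' (\<mu>' (f x) (f y)) (f z) = \<mu>' (f x) (\<mu>' (f y) (f z)))"
    by (simp add: f(2))
  also have "\<dots> \<longleftrightarrow> associative \<mu>'"
    unfolding associative_iff by (metis bij_pointE[OF f(1)])
  finally show ?thesis .
qed

lemma two_neq_zero:
  assumes "CHAR('k::field) \<noteq> 2"
  shows "(2 :: 'k) \<noteq> 0"
proof
  assume "(2 :: 'k) = 0"
  then have "of_nat 2 = (0 :: 'k)" by simp
  then have "CHAR('k) dvd 2" by (simp only: of_nat_eq_0_iff_char_dvd)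
  then show False
    using assms CHAR_not_1[where ?'a = 'k] prime_nat_iff two_is_prime_nat by (metis One_nat_def)
qed

section \<open>Ordered bases of a plane and the product in coordinates\<close>

locale planar_algebra = vector_space smul
  for smul :: "'k::field \<Rightarrow> 'v::ab_group_add \<Rightarrow> 'v" (infixr "*s" 75) +
  fixes \<mu> :: "'v \<Rightarrow> 'v \<Rightarrow> 'v"
  assumes K_algebra: "K_algebra smul \<mu>"
    and dim_UNIV: "dim (UNIV :: 'v set) = 2"
begin

lemma mult_simps:
  "\<mu> (x + y) z = \<mu> x z + \<mu> y z" "\<mu> x (y + z) = \<mu> x y + \<mu> x z"
  "\<mu> (c *s x) z = c *s \<mu> x z" "\<mu> x (c *s z) = c *s \<mu> x z"
  using K_algebra unfolding K_algebra_def linear_iff_module_hom module_hom_iff by auto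

text \<open>An ordered basis, encoded by its coordinate parametrisation: bijectivity yields
  existence and uniqueness of coordinates together, and the inverse map is the isomorphism onto a
  table.\<close>

definition frame :: "'v \<Rightarrow> 'v \<Rightarrow> bool" where
  "frame x y \<longleftrightarrow> bij (\<lambda>(a, b). a *s x + b *s y)"

lemma frame_eq_iff:
  assumes "frame x y"
  shows "a *s x + b *s y = a' *s x + b' *s y \<longleftrightarrow> a = a' \<and> b = b'"
  using inj_eq[OF bij_is_inj[OF assms[unfolded frame_def]], of "(a, b)" "(a', b')"] by simp

lemma frameE:
  assumes "frame x y"
  obtains a b where "v = a *s x + b *s y"
  using bij_pointE[OF assms[unfolded frame_def], of v] by (metis case_prod_conv surj_pair)

lemma ex_frame: "\<exists>x y. frame x y"
proof -
  obtain B where B: "independent B" "UNIV \<subseteq> span B" "card B = 2"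
    using basis_exists[of UNIV] dim_UNIV by metis
  then obtain x y where xy: "B = {x, y}" "x \<noteq> y"
    by (auto simp: card_2_iff)
  have "\<exists>a b. v = a *s x + b *s y" for v
  proof -
    have "v \<in> span {x, y}" using B xy by auto
    then obtain a b where "v - a *s x = b *s y"
      by (auto simp: span_insert span_singleton)
    then show ?thesis by (metis add.commute diff_add_cancel)
  qed
  moreover have "inj (\<lambda>(a, b). a *s x + b *s y)"
  proof (rule injI, clarify)
    fix a b a' b' assume eq: "a *s x + b *s y = a' *s x + b' *s y"
    \<comment> \<open>Coefficients of the linear dependence on \<open>{x, y}\<close> obtained by
      subtracting the two representations.\<close>
    define u where "u v = (if v = x then a - a' else b - b')" for v
    have "(\<Sum>v\<in>{x, y}. u v *s v) = 0"
      using xy(2) eq by (simp add: u_def scale_left_diff_distrib algebra_simps)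
    then have "\<forall>v\<in>{x, y}. u v = 0"
      using B(1) xy(1) dependent_finite[of "{x, y}"] by auto
    then show "a = a' \<and> b = b'"
      using xy(2) by (auto simp: u_def split: if_splits)
  qed
  ultimately have "frame x y"
    unfolding frame_def by (auto simp: bij_def image_def)
  then show ?thesis by blast
qed

lemma frame_change:
  assumes fr: "frame x y" and det: "a * d - b * c \<noteq> 0"
  shows "frame (a *s x + b *s y) (c *s x + d *s y)"
proof -
  let ?g = "\<lambda>(p, q). p *s x + q *s y" and ?h = "\<lambda>(p, q). (p * a + q * c, p * b + q * d)"
  \<comment> \<open>The inverse of \<open>?h\<close> by Cramer's rule.\<close>
  let ?k = "\<lambda>(p, q). ((p * d - q * c) / (a * d - b * c), (q * a - p * b) / (a * d - b * c))"
  have "bij ?h"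
    by (rule o_bij[of ?k]; insert det; auto simp: fun_eq_iff divide_simps; algebra)
  then have "bij (?g \<circ> ?h)"
    using fr by (simp add: frame_def bij_comp)
  moreover have "?g \<circ> ?h = (\<lambda>(p, q). p *s (a *s x + b *s y) + q *s (c *s x + d *s y))"
    by (auto simp: fun_eq_iff scale_right_distrib scale_left_distrib algebra_simps)
  ultimately show ?thesis by (simp add: frame_def)
qed

text \<open>The isomorphism is the coordinate map \<open>h\<close>. Linearity and multiplicativity
  are checked on its explicit inverse \<open>g\<close> and then carried over.\<close>

lemma isomorphic_to_tableI:
  assumes fr: "frame x y"
    and products: "\<mu> x x = a *s x + a' *s y" "\<mu> x y = b *s x + b' *s y"
      "\<mu> y x = c *s x + c' *s y" "\<mu> y y = d *s x + d' *s y"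
  shows "isomorphic_to_table smul \<mu> (a, a') (b, b') (c, c') (d, d')"
proof -
  define g where "g = (\<lambda>(p, q). p *s x + q *s y)"
  let ?T = "table_mult (a, a') (b, b') (c, c') (d, d')"
  define h where "h = inv_into UNIV g"
  have bij: "bij g" using fr by (simp add: frame_def g_def)
  have ig: "h (g u) = u" for u using bij by (simp add: h_def bij_is_inj)
  have gi: "g (h v) = v" for v using bij by (simp add: h_def bij_is_surj surj_f_inv_f)
  have add: "g (u + v) = g u + g v" for u v
    by (cases u, cases v) (simp add: g_def scale_left_distrib algebra_simps)
  have scl: "g (pair_scale r u) = r *s g u" for r u
    by (cases u) (simp add: g_def scale_right_distrib)
  have mul: "g (?T u v) = \<mu> (g u) (g v)" for u v
    by (cases u, cases v) (simp add: g_def table_mult_def mult_simps products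
        scale_left_distrib scale_right_distrib algebra_simps)
  interpret P: vector_space "pair_scale :: 'k \<Rightarrow> _" by (rule vector_space_pair_scale)
  have "Vector_Spaces.linear smul pair_scale h"
    unfolding linear_iff_module_hom module_hom_iff
    using module_axioms P.module_axioms by (auto; metis add scl ig gi)
  moreover have "h (\<mu> u v) = ?T (h u) (h v)" for u v
    by (metis mul ig gi)
  ultimately show ?thesis
    unfolding isomorphic_to_table_def algebra_isomorphic_def
    using bij_imp_bij_inv[OF bij, folded h_def] by blast
qed

section \<open>The commutator and the structure constants\<close>

text \<open>Every commutator is \<open>w\<close> times the determinant of the coordinates, so
  \<open>w\<close> is nonzero. A second vector for which this determinant is 2 completes
  \<open>w\<close> to a frame and satisfies the relation.\<close>

lemma ex_commutator_frame:
  assumes "noncommutative \<mu>" and two: "(2 :: 'k) \<noteq> 0"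
  shows "\<exists>x y. frame x y \<and> \<mu> x y = \<mu> y x + 2 *s x"
proof -
  obtain x y where fr: "frame x y" using ex_frame by blast
  define w where "w = \<mu> x y - \<mu> y x"
  have comm: "\<mu> (a *s x + b *s y) (c *s x + d *s y) - \<mu> (c *s x + d *s y) (a *s x + b *s y)
      = (a * d - b * c) *s w" for a b c d
    by (simp add: w_def mult_simps scale_left_diff_distrib scale_right_diff_distrib
        scale_left_distrib scale_right_distrib algebra_simps)
  obtain u v where uv: "\<mu> u v \<noteq> \<mu> v u"
    using assms(1) by (auto simp: noncommutative_def)
  obtain a b where ab: "w = a *s x + b *s y" using frameE[OF fr] .
  have "a \<noteq> 0 \<or> b \<noteq> 0"
  proof (rule ccontr)
    assume "\<not> ?thesis"
    then have "w = 0" using ab by simp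
    then show False using uv comm by (metis frameE[OF fr] eq_iff_diff_eq_0 scale_zero_right)
  qed
  \<comment> \<open>If \<open>a\<close> is nonzero, \<open>c = 0\<close> and
    \<open>d = 2 / a\<close> will do; otherwise \<open>d = 0\<close> and
    \<open>c = -2 / b\<close>.\<close>
  then obtain c d where cd: "a * d - b * c = 2"
    by (metis diff_zero diff_0_right mult_zero_right minus_mult_right minus_minus diff_0
        nonzero_mult_div_cancel_left times_divide_eq_right)
  show ?thesis
  proof (intro exI conjI)
    show "frame w (c *s x + d *s y)"
      unfolding ab by (rule frame_change[OF fr]) (simp add: cd two)
    show "\<mu> w (c *s x + d *s y) = \<mu> (c *s x + d *s y) w + 2 *s w"
      using comm[of a b c d] by (simp add: cd flip: ab) (metis add.commute diff_add_cancel)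
  qed
qed

text \<open>Symmetry of the associator in its first two arguments turns the product of
  \<open>\<mu> x y - \<mu> y x\<close> with \<open>z\<close> into a commutator of left
  multiplications, which is \<open>ls\<close>. Its coordinates at \<open>z = x\<close> give the
  first two equations, those at \<open>z = y\<close> the last two.\<close>

lemma structure_equations:
  assumes fr: "frame x y" and comm: "\<mu> x y = \<mu> y x + 2 *s x"
    and G2: "G_associative smul G2 \<mu>"
    and xx: "\<mu> x x = a *s x + b *s y" and yx: "\<mu> y x = c *s x + d *s y"
    and yy: "\<mu> y y = g *s x + h *s y"
  shows "(c + 2) * d - g * b = 2 * a" "b * c + d * d - (d * a + h * b) = 2 * b"
    "a * g + (c + 2) * h - (c * (c + 2) + g * d) = 2 * (c + 2)" "b * g - d * (c + 2) = 2 * d"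
proof -
  have xy: "\<mu> x y = (c + 2) *s x + d *s y"
    by (simp add: comm yx scale_left_distrib algebra_simps)
  have ls: "2 *s \<mu> x z = \<mu> x (\<mu> y z) - \<mu> y (\<mu> x z)" for z
  proof -
    have "associator \<mu> x y z = associator \<mu> y x z"
      using G2 by (simp add: G2_associative_iff[OF K_algebra])
    then show ?thesis
      by (simp add: associator_def comm mult_simps algebra_simps)
  qed
  have "(2 * a) *s x + (2 * b) *s y =
      ((c + 2) * d - g * b) *s x + (b * c + d * d - (d * a + h * b)) *s y"
    using ls[of x]
    by (simp add: mult_simps xx xy yx yy scale_right_distrib scale_left_distrib
        scale_left_diff_distrib algebra_simps)
  then show "(c + 2) * d - g * b = 2 * a" "b * c + d * d - (d * a + h * b) = 2 * b"
    by (simp_all add: frame_eq_iff[OF fr])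
  have "(2 * (c + 2)) *s x + (2 * d) *s y =
      (a * g + (c + 2) * h - (c * (c + 2) + g * d)) *s x + (b * g - d * (c + 2)) *s y"
    using ls[of y]
    by (simp add: mult_simps xx xy yx yy scale_right_distrib scale_left_distrib
        scale_left_diff_distrib algebra_simps)
  then show "a * g + (c + 2) * h - (c * (c + 2) + g * d) = 2 * (c + 2)"
      "b * g - d * (c + 2) = 2 * d"
    by (simp_all add: frame_eq_iff[OF fr])
qed

section \<open>Normal forms\<close>

text \<open>Since \<open>b\<close> is nonzero, a multiple \<open>u\<close> of \<open>x\<close> and
  its own square can serve as the new frame. For the square to have \<open>y\<close>-coordinate 1,
  and so keep the commutator relation, the factor \<open>s\<close> must be a square root of
  \<open>1 / b\<close>. The structure equations then fix all remaining constants.\<close>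

lemma normal_form_square_nonzero:
  assumes fr: "frame x y" and comm: "\<mu> x y = \<mu> y x + 2 *s x"
    and G2: "G_associative smul G2 \<mu>" and two: "(2 :: 'k) \<noteq> 0"
    and xx: "\<mu> x x = a *s x + b *s y" and b: "b \<noteq> 0" and s: "s ^ 2 = 1 / b"
  shows "isomorphic_to_table smul \<mu> (0, 1) (0, 0) (-2, 0) (0, -4)"
proof -
  define u v where "u = s *s x + 0 *s y" and "v = (a / b) *s x + 1 *s y"
  have "s \<noteq> 0" using s b by auto
  then have fr': "frame u v"
    unfolding u_def v_def by (intro frame_change[OF fr]) simp
  have comm': "\<mu> u v = \<mu> v u + 2 *s u"
    by (simp add: u_def v_def mult_simps comm scale_right_distrib algebra_simps)
  have "\<mu> u u = s ^ 2 *s \<mu> x x"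
    by (simp add: u_def mult_simps power2_eq_square)
  also have "\<dots> = v"
    using b by (simp add: s xx v_def scale_right_distrib)
  finally have uu: "\<mu> u u = 0 *s u + 1 *s v" by simp
  obtain c d where vu: "\<mu> v u = c *s u + d *s v" using frameE[OF fr'] .
  obtain g h where vv: "\<mu> v v = g *s u + h *s v" using frameE[OF fr'] .
  note eqs = structure_equations[OF fr' comm' G2 uu vu vv]
  \<comment> \<open>With \<open>\<mu> u u = v\<close> these equations give two values for
    \<open>g\<close> that differ by \<open>2 * d\<close>.\<close>
  have "2 * d = 0" using eqs(1,4) by algebra
  then have d: "d = 0" using two by simp
  have g: "g = 0" using eqs(1) d by simp
  have h: "h = c - 2" using eqs(2) d by (simp add: algebra_simps)
  have "2 * (2 * (c + 2)) = 0" using eqs(3) d g h by algebra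
  then have c: "c = -2" using two unfolding mult_eq_0_iff by (simp add: eq_neg_iff_add_eq_0)
  show ?thesis
    using uu vu vv comm' by (intro isomorphic_to_tableI[OF fr']) (simp_all add: c d g h)
qed

text \<open>Replacing \<open>y\<close> by \<open>y + t x\<close> changes the coefficient
  \<open>g\<close> to \<open>g - t (h + 2)\<close>, so it can be removed unless
  \<open>h = -2\<close>. In that exceptional case a nonzero \<open>g\<close> can only be scaled to
  1.\<close>

lemma normal_form_mult_zero:
  assumes fr: "frame x y" and xx: "\<mu> x x = 0" and xy: "\<mu> x y = 0" and yx: "\<mu> y x = (-2) *s x"
    and yy: "\<mu> y y = g *s x + h *s y"
  shows "(\<exists>\<beta>. isomorphic_to_table smul \<mu> (0, 0) (0, 0) (-2, 0) (0, \<beta>)) \<or>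
    isomorphic_to_table smul \<mu> (0, 0) (0, 0) (-2, 0) (1, -2)"
proof -
  consider "h \<noteq> -2" | "h = -2" "g = 0" | "h = -2" "g \<noteq> 0" by blast
  then show ?thesis
  proof cases
    case 1
    define t where "t = g / (h + 2)"
    define v where "v = t *s x + 1 *s y"
    have "h + 2 \<noteq> 0" using 1 by (simp add: eq_neg_iff_add_eq_0)
    then have "t * (h + 2) = g" by (simp add: t_def)
    then have t: "t * h + t * 2 = g" by (simp add: distrib_left)
    \<comment> \<open>The trivial coefficients give \<open>x\<close> the shape that
      \<open>frame_change\<close> expects.\<close>
    have "frame (1 *s x + 0 *s y) v"
      unfolding v_def by (intro frame_change[OF fr]) simp
    then have fr': "frame x v" by simp
    have vv: "\<mu> v v = 0 *s x + h *s v"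
      using t[symmetric] by (simp add: v_def mult_simps xx xy yx yy scale_right_distrib scale_left_distrib algebra_simps)
    have "\<mu> x v = 0" "\<mu> v x = (-2) *s x"
      by (simp_all add: v_def mult_simps xx xy yx)
    then have "isomorphic_to_table smul \<mu> (0, 0) (0, 0) (-2, 0) (0, h)"
      using vv by (intro isomorphic_to_tableI[OF fr']) (simp_all add: xx)
    then show ?thesis by blast
  next
    case 2
    then have "isomorphic_to_table smul \<mu> (0, 0) (0, 0) (-2, 0) (0, h)"
      by (intro isomorphic_to_tableI[OF fr]) (simp_all add: xx xy yx yy)
    then show ?thesis by blast
  next
    case 3
    then have fr': "frame (g *s x + 0 *s y) (0 *s x + 1 *s y)"
      by (intro frame_change[OF fr]) simp
    then have "isomorphic_to_table smul \<mu> (0, 0) (0, 0) (-2, 0) (1, -2)"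
      using 3 by (intro isomorphic_to_tableI[OF fr']) (simp_all add: mult_simps xx xy yx yy mult.commute)
    then show ?thesis by blast
  qed
qed

text \<open>Here replacing \<open>y\<close> by \<open>y + t x\<close> changes \<open>g\<close> to
  \<open>g + c t\<close>, so the exceptional value is \<open>c = 0\<close>, where a nonzero
  \<open>g\<close> is scaled to 1.\<close>

lemma normal_form_mult_scalar:
  assumes fr: "frame x y" and xx: "\<mu> x x = 0" and xy: "\<mu> x y = (c + 2) *s x" and yx: "\<mu> y x = c *s x"
    and yy: "\<mu> y y = g *s x + (c + 2) *s y"
  shows "(\<exists>\<alpha>. isomorphic_to_table smul \<mu> (0, 0) (\<alpha> + 1, 0) (\<alpha> - 1, 0) (0, \<alpha> + 1)) \<or>
    isomorphic_to_table smul \<mu> (0, 0) (2, 0) (0, 0) (1, 2)"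
proof -
  have table: "\<exists>\<alpha>. isomorphic_to_table smul \<mu> (0, 0) (\<alpha> + 1, 0) (\<alpha> - 1, 0) (0, \<alpha> + 1)"
    if "isomorphic_to_table smul \<mu> (0, 0) (c + 2, 0) (c, 0) (0, c + 2)"
    \<comment> \<open>The parameter \<alpha> is the mean of the coefficients \<open>c + 2\<close>
      and \<open>c\<close>.\<close>
    using that by (intro exI[of _ "c + 1"]) (simp add: add.assoc)
  consider "c \<noteq> 0" | "c = 0" "g = 0" | "c = 0" "g \<noteq> 0" by blast
  then show ?thesis
  proof cases
    case 1
    define t where "t = - g / c"
    define v where "v = t *s x + 1 *s y"
    have t: "g = - (c * t)" using 1 by (simp add: t_def)
    have "frame (1 *s x + 0 *s y) v"
      unfolding v_def by (intro frame_change[OF fr]) simp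
    then have fr': "frame x v" by simp
    have vv: "\<mu> v v = 0 *s x + (c + 2) *s v"
      by (simp add: t v_def mult_simps xx xy yx yy scale_right_distrib scale_left_distrib algebra_simps)
    have "\<mu> x v = (c + 2) *s x" "\<mu> v x = c *s x"
      by (simp_all add: v_def mult_simps xx xy yx)
    then have "isomorphic_to_table smul \<mu> (0, 0) (c + 2, 0) (c, 0) (0, c + 2)"
      using vv by (intro isomorphic_to_tableI[OF fr']) (simp_all add: xx)
    then show ?thesis using table by blast
  next
    case 2
    then have "isomorphic_to_table smul \<mu> (0, 0) (c + 2, 0) (c, 0) (0, c + 2)"
      by (intro isomorphic_to_tableI[OF fr]) (simp_all add: xx xy yx yy)
    then show ?thesis using table by blast
  next
    case 3
    then have fr': "frame (g *s x + 0 *s y) (0 *s x + 1 *s y)"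
      by (intro frame_change[OF fr]) simp
    then have "isomorphic_to_table smul \<mu> (0, 0) (2, 0) (0, 0) (1, 2)"
      using 3 by (intro isomorphic_to_tableI[OF fr']) (simp_all add: mult_simps xx xy yx yy mult.commute)
    then show ?thesis by blast
  qed
qed

lemma classification:
  assumes two: "(2 :: 'k) \<noteq> 0" and sqrt: "\<And>r :: 'k. \<exists>s. s ^ 2 = r"
    and noncomm: "noncommutative \<mu>" and G2: "G_associative smul G2 \<mu>"
  shows "isomorphic_to_table smul \<mu> (0, 1) (0, 0) (-2, 0) (0, -4) \<or>
     (\<exists>\<beta>. isomorphic_to_table smul \<mu> (0, 0) (0, 0) (-2, 0) (0, \<beta>)) \<or>
     (\<exists>\<alpha>. isomorphic_to_table smul \<mu> (0, 0) (\<alpha> + 1, 0) (\<alpha> - 1, 0) (0, \<alpha> + 1)) \<or>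
     isomorphic_to_table smul \<mu> (0, 0) (2, 0) (0, 0) (1, 2) \<or>
     isomorphic_to_table smul \<mu> (0, 0) (0, 0) (-2, 0) (1, -2)"
proof -
  obtain x y where fr: "frame x y" and comm: "\<mu> x y = \<mu> y x + 2 *s x"
    using ex_commutator_frame[OF noncomm two] by blast
  obtain a b where xx: "\<mu> x x = a *s x + b *s y" using frameE[OF fr] .
  obtain c d where yx: "\<mu> y x = c *s x + d *s y" using frameE[OF fr] .
  obtain g h where yy: "\<mu> y y = g *s x + h *s y" using frameE[OF fr] .
  note eqs = structure_equations[OF fr comm G2 xx yx yy]
  show ?thesis
  \<comment> \<open>Testing \<open>b\<close> alone decides whether \<open>\<mu> x x\<close>
    vanishes, because \<open>b = 0\<close> will force \<open>a = 0\<close>.\<close>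
  proof (cases "b = 0")
    case False
    then show ?thesis
      using normal_form_square_nonzero[OF fr comm G2 two xx] sqrt by blast
  next
    case b: True
    \<comment> \<open>The sum of the diagonal entries of the commutator identity: twice the trace of
      left multiplication by \<open>x\<close> is the trace of a commutator, hence 0.\<close>
    have "2 * (a + d) = 0" using eqs(1,4) b by algebra
    then have a: "a = - d" using two unfolding mult_eq_0_iff by (simp add: eq_neg_iff_add_eq_0)
    have "2 * (d * d) = 0" using eqs(2) a b by algebra
    then have d: "d = 0" using two by simp
    have xx': "\<mu> x x = 0" using xx a b d by simp
    have yx': "\<mu> y x = c *s x" using yx d by simp
    have xy': "\<mu> x y = (c + 2) *s x" using comm yx' by (simp add: scale_left_distrib)
    \<comment> \<open>The two factors separate the remaining families: either
      \<open>\<mu> x y = 0\<close>, or \<open>y\<close> has the same eigenvalue \<open>c + 2\<close>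
      in \<open>\<mu> y y\<close> as \<open>x\<close> has in \<open>\<mu> x y\<close>.\<close>
    have "(c + 2) * (h - (c + 2)) = 0" using eqs(3) a d by algebra
    then consider "c = -2" | "h = c + 2"
      by (auto simp: eq_neg_iff_add_eq_0)
    then show ?thesis
    proof cases
      case 1
      then show ?thesis using normal_form_mult_zero[OF fr xx' _ _ yy] xy' yx' by auto
    next
      case 2
      then show ?thesis using normal_form_mult_scalar[OF fr xx' xy' yx'] yy by blast
    qed
  qed
qed

end

section \<open>The associative algebras among the normal forms\<close>

lemma associative_tables:
  "associative (table_mult (0, 0) (0, 0) (-2, 0) (0, -2) :: 'k::field \<times> 'k \<Rightarrow> _)"
  "associative (table_mult (0, 0) (2, 0) (0, 0) (0, 2) :: 'k \<times> 'k \<Rightarrow> _)"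
  by (auto simp: associative_iff table_mult_def algebra_simps)

text \<open>One triple of basis vectors settles each table: \<open>e1, e1, e1\<close> the first,
  \<open>e2, e2, e1\<close> the two families, and \<open>e2, e2, e2\<close> the last two. The
  surviving parameters \<beta> = -2 and \<alpha> = 1 give exactly the tables of
  \<open>associative_tables\<close>.\<close>

lemma associative_table_cases:
  fixes \<beta> \<alpha> :: "'k::field"
  assumes two: "(2 :: 'k) \<noteq> 0"
  shows "\<not> associative (table_mult (0, 1) (0, 0) (-2, 0) (0, -4 :: 'k))"
    and "associative (table_mult (0, 0) (0, 0) (-2, 0) (0, \<beta>)) \<Longrightarrow> \<beta> = -2"
    and "associative (table_mult (0, 0) (\<alpha> + 1, 0) (\<alpha> - 1, 0) (0, \<alpha> + 1)) \<Longrightarrow> \<alpha> = 1"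
    and "\<not> associative (table_mult (0, 0) (2, 0) (0, 0) (1, 2 :: 'k))"
    and "\<not> associative (table_mult (0, 0) (0, 0) (-2, 0) (1, -2 :: 'k))"
proof -
  show "\<not> associative (table_mult (0, 1) (0, 0) (-2, 0) (0, -4 :: 'k))"
  proof
    assume "associative (table_mult (0, 1) (0, 0) (-2, 0) (0, -4 :: 'k))"
    from this[unfolded associative_iff, rule_format, of "(1, 0)" "(1, 0)" "(1, 0)"]
    show False using two by (simp add: table_mult_def)
  qed
  show "\<beta> = -2" if "associative (table_mult (0, 0) (0, 0) (-2, 0) (0, \<beta>))"
  proof -
    have "- 2 * (\<beta> + 2) = 0"
      using that[unfolded associative_iff, rule_format, of "(0, 1)" "(0, 1)" "(1, 0)"]
      by (simp add: table_mult_def algebra_simps)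
    then show ?thesis using two unfolding mult_eq_0_iff by (simp add: eq_neg_iff_add_eq_0)
  qed
  show "\<alpha> = 1" if "associative (table_mult (0, 0) (\<alpha> + 1, 0) (\<alpha> - 1, 0) (0, \<alpha> + 1))"
  proof -
    have "2 * (\<alpha> - 1) = 0"
      using that[unfolded associative_iff, rule_format, of "(0, 1)" "(0, 1)" "(1, 0)"]
      by (simp add: table_mult_def algebra_simps)
    then show ?thesis using two by simp
  qed
  show "\<not> associative (table_mult (0, 0) (2, 0) (0, 0) (1, 2 :: 'k))"
  proof
    assume "associative (table_mult (0, 0) (2, 0) (0, 0) (1, 2 :: 'k))"
    from this[unfolded associative_iff, rule_format, of "(0, 1)" "(0, 1)" "(0, 1)"]
    have "2 + 2 = (2 :: 'k)" by (simp add: table_mult_def)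
    then show False using two by (simp only: add_cancel_left_right)
  qed
  show "\<not> associative (table_mult (0, 0) (0, 0) (-2, 0) (1, -2 :: 'k))"
  proof
    assume "associative (table_mult (0, 0) (0, 0) (-2, 0) (1, -2 :: 'k))"
    from this[unfolded associative_iff, rule_format, of "(0, 1)" "(0, 1)" "(0, 1)", symmetric]
    have "2 + 2 = (2 :: 'k)" by (simp add: table_mult_def)
    then show False using two by (simp only: add_cancel_left_right)
  qed
qed

theorem proposition8:
  fixes smul :: "'k::alg_closed_field \<Rightarrow> 'v::ab_group_add \<Rightarrow> 'v"
    and \<mu> :: "'v \<Rightarrow> 'v \<Rightarrow> 'v"
  assumes "CHAR('k) \<noteq> 2"
    and "K_algebra smul \<mu>"
    and "vector_space.dim smul (UNIV :: 'v set) = 2"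
    and "noncommutative \<mu>"
    and "G_associative smul G2 \<mu>"
  shows
    "((isomorphic_to_table smul \<mu> (0, 0) (0, 0) (-2, 0) (0, -2) \<or>
      isomorphic_to_table smul \<mu> (0, 0) (2, 0) (0, 0) (0, 2)) \<or>
     isomorphic_to_table smul \<mu> (0, 1) (0, 0) (-2, 0) (0, -4) \<or>
     (\<exists>\<beta>\<^sub>4. isomorphic_to_table smul \<mu> (0, 0) (0, 0) (-2, 0) (0, \<beta>\<^sub>4)) \<or>
     (\<exists>\<alpha>\<^sub>2. isomorphic_to_table smul \<mu> (0, 0) (\<alpha>\<^sub>2 + 1, 0) (\<alpha>\<^sub>2 - 1, 0) (0, \<alpha>\<^sub>2 + 1)) \<or>
     isomorphic_to_table smul \<mu> (0, 0) (2, 0) (0, 0) (1, 2) \<or>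
     isomorphic_to_table smul \<mu> (0, 0) (0, 0) (-2, 0) (1, -2)) \<and>
     (associative \<mu> \<longleftrightarrow>
       isomorphic_to_table smul \<mu> (0, 0) (0, 0) (-2, 0) (0, -2) \<or>
       isomorphic_to_table smul \<mu> (0, 0) (2, 0) (0, 0) (0, 2))"
proof -
  interpret planar_algebra smul \<mu>
    using assms(2,3) by (simp add: planar_algebra_def planar_algebra_axioms_def K_algebra_def)
  have two: "(2 :: 'k) \<noteq> 0" using two_neq_zero[OF assms(1)] .
  have sqrt: "\<exists>s. s ^ 2 = r" for r :: 'k
    using nth_root_exists[of 2 r] by auto
  note tables = classification[OF two sqrt assms(4,5)]
  have transfer: "associative \<mu> \<longleftrightarrow> associative (table_mult p q r s)"
    if "isomorphic_to_table smul \<mu> p q r s" for p q r s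
    using algebra_isomorphic_associative that unfolding isomorphic_to_table_def by blast
  let ?A = "isomorphic_to_table smul \<mu> (0, 0) (0, 0) (-2, 0) (0, -2) \<or>
      isomorphic_to_table smul \<mu> (0, 0) (2, 0) (0, 0) (0, 2)"
  have "associative \<mu> \<longleftrightarrow> ?A"
  proof
    assume "?A"
    then show "associative \<mu>" using transfer associative_tables by blast
  next
    assume assoc: "associative \<mu>"
    \<comment> \<open>Associativity pins the parameter of each family to the value at which its
      table is one of the two in \<open>?A\<close>; the other three normal forms are
      excluded.\<close>
    have "?A" if "isomorphic_to_table smul \<mu> (0, 0) (0, 0) (-2, 0) (0, \<beta>)" for \<beta>
      using that transfer[OF that] assoc associative_table_cases(2)[OF two, of \<beta>] by simp
    moreover have "?A"
      if "isomorphic_to_table smul \<mu> (0, 0) (\<alpha> + 1, 0) (\<alpha> - 1, 0) (0, \<alpha> + 1)" for \<alpha>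
      using that transfer[OF that] assoc associative_table_cases(3)[OF two, of \<alpha>] by simp
    ultimately show "?A"
      using tables assoc transfer associative_table_cases(1,4,5)[OF two] by blast
  qed
  then show ?thesis using tables by blast
qed

end
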